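(* For every integer $n\ge2$, the hybrid Fibonacci spinors $FSH_n$ and hybrid Lucas spinors $LSH_n$ satisfy: (i) $FSH_{n+2}-FSH_{n-2}=LSH_n$; (ii) $5\,FSH_n+LSH_n=2\,LSH_{n+1}$.
   Context: $h$ is the hyperbolic unit: $h^2=1$, $h\notin\mathbb{R}$, so entries lie in the commutative ring of hyperbolic (split-complex) numbers $\{a+hb: a,b\in\mathbb{R}\}\cong\mathbb{R}[h]/(h^2-1)$. $F_n$ is the Fibonacci sequence ($F_0=0$, $F_1=1$, $F_{n+1}=F_n+F_{n-1}$) and $L_n$ is the Lucas sequence ($L_0=2$, $L_1=1$, $L_{n+1}=L_n+L_{n-1}$). For $n\ge0$ the $n$th hybrid Fibonacci and Lucas spinors are the column vectors $$FSH_n=\begin{bmatrix}F_n+hF_{n+2}\\ (F_{n+2}-F_{n+1})+hF_{n+3}\end{bmatrix},\qquad LSH_n=\begin{bmatrix}L_n+hL_{n+2}\\ L_n+hL_{n+3}\end{bmatrix}.$$ *)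

theory Defs
  imports "HOL-Analysis.Cartesian_Space" "HOL-Number_Theory.Fib"
begin

text \<open>
  The ring \<open>\<real>[h]/(h\<^sup>2 - 1)\<close> of hyperbolic (split-complex) numbers;
  \<open>Hyperbolic a b\<close> stands for \<open>a + h b\<close>.
\<close>

datatype hyperbolic = Hyperbolic (hre: real) (him: real)

lemma hyperbolic_eq_iff: "x = y \<longleftrightarrow> hre x = hre y \<and> him x = him y"
  by (auto intro: hyperbolic.expand)

instantiation hyperbolic :: "{comm_ring_1, real_algebra_1}"
begin

definition "0 = Hyperbolic 0 0"
definition "1 = Hyperbolic 1 0"
definition "x + y = Hyperbolic (hre x + hre y) (him x + him y)" for x y :: hyperbolic
definition "- x = Hyperbolic (- hre x) (- him x)" for x :: hyperbolic
definition "x - y = Hyperbolic (hre x - hre y) (him x - him y)" for x y :: hyperbolic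
definition "x * y = Hyperbolic (hre x * hre y + him x * him y) (hre x * him y + him x * hre y)"
  for x y :: hyperbolic
definition "r *\<^sub>R x = Hyperbolic (r * hre x) (r * him x)" for x :: hyperbolic

instance
  by standard
    (simp_all add: zero_hyperbolic_def one_hyperbolic_def plus_hyperbolic_def
      uminus_hyperbolic_def minus_hyperbolic_def times_hyperbolic_def
      scaleR_hyperbolic_def algebra_simps)

end

definition hyp_unit :: hyperbolic  (\<open>\<h>\<close>)
  where "\<h> = Hyperbolic 0 1"

lemma hyp_unit_square: "\<h>\<^sup>2 = 1"
  by (simp add: power2_eq_square hyp_unit_def times_hyperbolic_def one_hyperbolic_def)

lemma of_real_hyperbolic: "of_real r = Hyperbolic r 0"
  by (simp add: of_real_def scaleR_hyperbolic_def one_hyperbolic_def)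

lemma hyp_unit_not_real: "\<h> \<notin> \<real>"
  by (auto simp: Reals_def of_real_hyperbolic hyp_unit_def)

lemma Hyperbolic_eq: "Hyperbolic a b = of_real a + \<h> * of_real b"
  by (simp add: of_real_hyperbolic hyp_unit_def times_hyperbolic_def plus_hyperbolic_def)

fun lucas :: "nat \<Rightarrow> nat" where
  "lucas 0 = 2"
| "lucas (Suc 0) = 1"
| "lucas (Suc (Suc n)) = lucas (Suc n) + lucas n"

text \<open>All sums and differences below are taken in the hyperbolic numbers, not in \<^typ>\<open>nat\<close>.\<close>

definition FSH :: "nat \<Rightarrow> hyperbolic ^ 2" where
  "FSH n = vector
     [of_nat (fib n) + \<h> * of_nat (fib (n + 2)),
      (of_nat (fib (n + 2)) - of_nat (fib (n + 1))) + \<h> * of_nat (fib (n + 3))]"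

definition LSH :: "nat \<Rightarrow> hyperbolic ^ 2" where
  "LSH n = vector
     [of_nat (lucas n) + \<h> * of_nat (lucas (n + 2)),
      of_nat (lucas n) + \<h> * of_nat (lucas (n + 3))]"

end

theory Submission
  imports Defs
begin

text \<open>Both claims are linear, so they split into scalar identities for the real and the
  \<open>\<h>\<close> coefficient of each component; \<open>\<h>\<^sup>2 = 1\<close> never enters.
  Once \<open>FSH_eq\<close> gives both spinors the same shape, the identities are
  \<open>fib_add_4\<close> and \<open>five_fib_add_lucas\<close> at shifted indices. In each, both
  sides obey the Fibonacci recurrence, so agreement at 0 and 1 suffices.\<close>

lemma fib_add_4: "fib (n + 4) = fib n + lucas (n + 2)"
  by (induction n rule: fib.induct) (simp_all add: eval_nat_numeral)

lemma five_fib_add_lucas: "5 * fib n + lucas n = 2 * lucas (n + 1)"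
  by (induction n rule: fib.induct) simp_all

text \<open>The recurrence collapses the difference in the second component, so that
  \<open>FSH\<close> matches \<open>LSH\<close> entry by entry.\<close>

lemma FSH_eq:
  "FSH n = vector [of_nat (fib n) + \<h> * of_nat (fib (n + 2)),
                   of_nat (fib n) + \<h> * of_nat (fib (n + 3))]"
  by (simp add: FSH_def)

theorem theorem4p8:
  fixes n :: nat
  assumes "n \<ge> 2"
  shows "FSH (n + 2) - FSH (n - 2) = LSH n \<and>
         5 *s FSH n + LSH n = 2 *s LSH (n + 1)"
proof
  \<comment> \<open>This removes the truncated subtraction in \<open>n - 2\<close>.\<close>
  obtain m where n: "n = m + 2"
    using assms by (metis add.commute le_Suc_ex)
  have diff: "of_nat (fib (k + 4)) - of_nat (fib k) = (of_nat (lucas (k + 2)) :: hyperbolic)" for k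
    by (simp only: fib_add_4 of_nat_add add_diff_cancel_left')
  have regroup: "(a + \<h> * b) - (c + \<h> * d) = (a - c) + \<h> * (b - d)" for a b c d
    by (simp add: algebra_simps)
  \<comment> \<open>Aligns the indices so that \<open>diff\<close> applies at \<open>m\<close>,
    \<open>m + 2\<close> and \<open>m + 3\<close>.\<close>
  have index: "m + 2 + 2 = m + 4" "m + 4 + 2 = (m + 2) + 4" "m + 4 + 3 = (m + 3) + 4"
    "m + 2 - 2 = m" "m + 2 + 3 = m + 3 + 2"
    by simp_all
  show "FSH (n + 2) - FSH (n - 2) = LSH n"
    unfolding n index FSH_eq LSH_def vec_eq_iff forall_2 vector_minus_component vector_2
      regroup diff by simp
next
  \<comment> \<open>The natural-number identity has no subtraction, so \<open>of_nat\<close> carries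
    it over directly.\<close>
  have five: "5 * of_nat (fib k) + of_nat (lucas k) = (2 * of_nat (lucas (k + 1)) :: hyperbolic)" for k
    using arg_cong[OF five_fib_add_lucas[of k], of "of_nat :: nat \<Rightarrow> hyperbolic"]
    by (simp only: of_nat_add of_nat_mult of_nat_numeral)
  have regroup: "5 * (a + \<h> * b) + (c + \<h> * d) = (5 * a + c) + \<h> * (5 * b + d)" for a b c d
    by (simp add: algebra_simps)
  have double: "2 * a + \<h> * (2 * b) = 2 * (a + \<h> * b)" for a b
    by (simp add: algebra_simps)
  have index: "n + 2 + 1 = n + 1 + 2" "n + 3 + 1 = n + 1 + 3"
    by simp_all
  show "5 *s FSH n + LSH n = 2 *s LSH (n + 1)"
    unfolding FSH_eq LSH_def vec_eq_iff forall_2 vector_add_component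
      vector_smult_component vector_2 regroup five double index by simp
qed

end
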